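(* Let $\bar x$ be feasible for the mathematical program with equilibrium constraints (MPEC) $$\min_{x\in\mathbb{R}^n} f(x)\ \text{ s.t. }\ g(x)\le 0,\ h(x)=0,\ G_i(x)\ge 0,\ H_i(x)\ge 0,\ G_i(x)H_i(x)=0,\ i=1,\ldots,q,$$ and assume that LICQ(0) is fulfilled at $\bar x$. Then $\bar x$ is strongly M-stationary if and only if it is S-stationary.
   Context: Data: $f:\mathbb{R}^n\to\mathbb{R}$, $g:\mathbb{R}^n\to\mathbb{R}^l$, $h:\mathbb{R}^n\to\mathbb{R}^p$, $G,H:\mathbb{R}^n\to\mathbb{R}^q$ are continuously differentiable and twice Fréchet differentiable at $\bar x$. Index sets: $\bar I_g=\{i : g_i(\bar x)=0\}$, $\bar I^{+0}=\{i : G_i(\bar x)>0=H_i(\bar x)\}$, $\bar I^{0+}=\{i : G_i(\bar x)=0<H_i(\bar x)\}$, $\bar I^{00}=\{i : G_i(\bar x)=0=H_i(\bar x)\}$. Active gradient family: $\{\nabla g_i(\bar x) : i\in\bar I_g\}\cup\{\nabla h_i(\bar x) : i=1,\dots,p\}\cup\{\nabla G_i(\bar x) : i\in\bar I^{0+}\cup\bar I^{00}\}\cup\{\nabla H_i(\bar x) : i\in\bar I^{+0}\cup\bar I^{00}\}$; let $r(\bar x)$ be its rank. For the MPEC, LICQ(0) means that this family is linearly independent (MPEC-LICQ). $\mathcal{L}(x,\lambda_0,\lambda)=\lambda_0f(x)+{\lambda^g}^Tg(x)+{\lambda^h}^Th(x)-{\lambda^G}^TG(x)-{\lambda^H}^TH(x)$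 for $\lambda=(\lambda^g,\lambda^h,\lambda^G,\lambda^H)\in\mathbb{R}^l\times\mathbb{R}^p\times\mathbb{R}^q\times\mathbb{R}^q$. $\Lambda^1(\bar x)$ is the set of $\lambda$ with $\nabla_x\mathcal{L}(\bar x,1,\lambda)=0$; $\lambda^g_i\ge 0$, $\lambda^g_ig_i(\bar x)=0$ for $i=1,\dots,l$; $\lambda^H_i=0$ for $i\in\bar I^{0+}$; $\lambda^G_i=0$ for $i\in\bar I^{+0}$; and, for $i\in\bar I^{00}$, either $\lambda^G_i>0,\lambda^H_i>0$ or $\lambda^G_i\lambda^H_i=0$. $\hat\Lambda^1(\bar x)$ is defined in the same way but with the last condition replaced by $\lambda^G_i\ge 0,\ \lambda^H_i\ge 0$ for $i\in\bar I^{00}$. $\bar x$ is S-stationary if $\hat\Lambda^1(\bar x)\neq\emptyset$. A triple $(J_g,J_G,J_H)$ with $J_g\subset\bar I_g$, $J_G\subset\bar I^{0+}\cup\bar I^{00}$, $J_H\subset\bar I^{+0}\cup\bar I^{00}$ is an MPEC working set if $J_G\cup J_H=\{1,\dots,q\}$, $|J_g|+p+|J_G|+|J_H|=r(\bar x)$, and the family $\{\nabla g_i(\bar x) : i\in J_g\}\cup\{\nabla h_i(\bar x) : i=1,\dots,p\}\cup\{\nabla G_i(\bar x) : i\in J_G\}\cup\{\nabla H_i(\bar x) : i\in J_H\}$ is linearly independent. $\bar x$ is strongly M-stationary if there are an MPEC working set $(J_g,J_G,J_H)$ and a multiplier $\lambda\in\Lambda^1(\bar x)$ with $\lambda^g_i=0$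 for $i\in\{1,\dots,l\}\setminus J_g$, $\lambda^G_i=0$ for $i\in\{1,\dots,q\}\setminus J_G$, $\lambda^H_i=0$ for $i\in\{1,\dots,q\}\setminus J_H$, and $\lambda^G_i\ge 0,\ \lambda^H_i\ge 0$ for $i\in J_G\cap J_H$. *)

theory Defs
  imports "HOL-Analysis.Analysis"
begin

definition gradient :: "('a::real_inner \<Rightarrow> real) \<Rightarrow> 'a \<Rightarrow> 'a" where
  "gradient \<phi> x = (THE D. GDERIV \<phi> x :> D)"

definition continuously_differentiable ::
    "('a::real_normed_vector \<Rightarrow> 'b::real_normed_vector) \<Rightarrow> bool" where
  "continuously_differentiable \<phi> \<longleftrightarrow>
    (\<exists>\<phi>' :: 'a \<Rightarrow> 'a \<Rightarrow>\<^sub>L 'b.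
       (\<forall>x. (\<phi> has_derivative blinfun_apply (\<phi>' x)) (at x)) \<and> continuous_on UNIV \<phi>')"

definition twice_frechet_differentiable_at ::
    "('a::real_normed_vector \<Rightarrow> 'b::real_normed_vector) \<Rightarrow> 'a \<Rightarrow> bool" where
  "twice_frechet_differentiable_at \<phi> x \<longleftrightarrow>
    (\<exists>\<phi>' :: 'a \<Rightarrow> 'a \<Rightarrow>\<^sub>L 'b.
       (\<forall>\<^sub>F y in nhds x. (\<phi> has_derivative blinfun_apply (\<phi>' y)) (at y)) \<and>
       \<phi>' differentiable (at x))"

text \<open>Independence is a property of the indexed family, not of its range: a repeated vector makes
  the family linearly dependent.\<close>

definition independent_family :: "'i set \<Rightarrow> ('i \<Rightarrow> 'a::real_vector) \<Rightarrow> bool" where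
  "independent_family K v \<longleftrightarrow> inj_on v K \<and> independent (v ` K)"

definition family_rank :: "'i set \<Rightarrow> ('i \<Rightarrow> 'a::real_vector) \<Rightarrow> nat" where
  "family_rank K v = dim (v ` K)"

text \<open>The maps into \<open>\<real>\<^sup>l\<close>, \<open>\<real>\<^sup>p\<close> and \<open>\<real>\<^sup>q\<close> are given by their components with indices in
  \<open>{1..l}\<close>, \<open>{1..p}\<close> and \<open>{1..q}\<close>, so that each of \<open>l\<close>, \<open>p\<close>, \<open>q\<close> may be \<open>0\<close>;
  components outside these ranges are irrelevant.\<close>

record 'a mpec =
  objective :: "'a \<Rightarrow> real"
  dim_l :: nat
  dim_p :: nat
  dim_q :: nat
  con_g :: "nat \<Rightarrow> 'a \<Rightarrow> real"
  con_h :: "nat \<Rightarrow> 'a \<Rightarrow> real"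
  con_G :: "nat \<Rightarrow> 'a \<Rightarrow> real"
  con_H :: "nat \<Rightarrow> 'a \<Rightarrow> real"

definition feasible :: "'a mpec \<Rightarrow> 'a \<Rightarrow> bool" where
  "feasible P x \<longleftrightarrow>
     (\<forall>i\<in>{1..dim_l P}. con_g P i x \<le> 0) \<and>
     (\<forall>i\<in>{1..dim_p P}. con_h P i x = 0) \<and>
     (\<forall>i\<in>{1..dim_q P}. con_G P i x \<ge> 0 \<and> con_H P i x \<ge> 0 \<and> con_G P i x * con_H P i x = 0)"

definition I_g :: "'a mpec \<Rightarrow> 'a \<Rightarrow> nat set" where
  "I_g P x = {i \<in> {1..dim_l P}. con_g P i x = 0}"

definition I_p0 :: "'a mpec \<Rightarrow> 'a \<Rightarrow> nat set" where
  "I_p0 P x = {i \<in> {1..dim_q P}. con_G P i x > 0 \<and> con_H P i x = 0}"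

definition I_0p :: "'a mpec \<Rightarrow> 'a \<Rightarrow> nat set" where
  "I_0p P x = {i \<in> {1..dim_q P}. con_G P i x = 0 \<and> con_H P i x > 0}"

definition I_00 :: "'a mpec \<Rightarrow> 'a \<Rightarrow> nat set" where
  "I_00 P x = {i \<in> {1..dim_q P}. con_G P i x = 0 \<and> con_H P i x = 0}"

datatype constraint = Cg nat | Ch nat | CG nat | CH nat

fun constraint_gradient :: "('a::real_inner) mpec \<Rightarrow> 'a \<Rightarrow> constraint \<Rightarrow> 'a" where
  "constraint_gradient P x (Cg i) = gradient (con_g P i) x"
| "constraint_gradient P x (Ch i) = gradient (con_h P i) x"
| "constraint_gradient P x (CG i) = gradient (con_G P i) x"
| "constraint_gradient P x (CH i) = gradient (con_H P i) x"

definition constraint_labels ::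
    "'a mpec \<Rightarrow> nat set \<Rightarrow> nat set \<Rightarrow> nat set \<Rightarrow> constraint set" where
  "constraint_labels P Jg JG JH = Cg ` Jg \<union> Ch ` {1..dim_p P} \<union> CG ` JG \<union> CH ` JH"

definition active_labels :: "'a mpec \<Rightarrow> 'a \<Rightarrow> constraint set" where
  "active_labels P x =
     constraint_labels P (I_g P x) (I_0p P x \<union> I_00 P x) (I_p0 P x \<union> I_00 P x)"

definition mpec_rank :: "('a::real_inner) mpec \<Rightarrow> 'a \<Rightarrow> nat" where
  "mpec_rank P x = family_rank (active_labels P x) (constraint_gradient P x)"

definition mpec_LICQ :: "('a::real_inner) mpec \<Rightarrow> 'a \<Rightarrow> bool" where
  "mpec_LICQ P x \<longleftrightarrow> independent_family (active_labels P x) (constraint_gradient P x)"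

definition mpec_working_set ::
    "('a::real_inner) mpec \<Rightarrow> 'a \<Rightarrow> nat set \<Rightarrow> nat set \<Rightarrow> nat set \<Rightarrow> bool" where
  "mpec_working_set P x Jg JG JH \<longleftrightarrow>
     Jg \<subseteq> I_g P x \<and> JG \<subseteq> I_0p P x \<union> I_00 P x \<and> JH \<subseteq> I_p0 P x \<union> I_00 P x \<and>
     JG \<union> JH = {1..dim_q P} \<and>
     card Jg + dim_p P + card JG + card JH = mpec_rank P x \<and>
     independent_family (constraint_labels P Jg JG JH) (constraint_gradient P x)"

record multiplier =
  mul_g :: "nat \<Rightarrow> real"
  mul_h :: "nat \<Rightarrow> real"
  mul_G :: "nat \<Rightarrow> real"
  mul_H :: "nat \<Rightarrow> real"

text \<open>\<open>\<real>\<^sup>l \<times> \<real>\<^sup>p \<times> \<real>\<^sup>q \<times> \<real>\<^sup>q\<close>, with \<open>\<real>\<^sup>k\<close> rendered as the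
  extensional functions on \<open>{1..k}\<close>.\<close>

definition multiplier_space :: "'a mpec \<Rightarrow> multiplier set" where
  "multiplier_space P =
     {m. mul_g m \<in> {1..dim_l P} \<rightarrow>\<^sub>E UNIV \<and> mul_h m \<in> {1..dim_p P} \<rightarrow>\<^sub>E UNIV \<and>
         mul_G m \<in> {1..dim_q P} \<rightarrow>\<^sub>E UNIV \<and> mul_H m \<in> {1..dim_q P} \<rightarrow>\<^sub>E UNIV}"

definition lagrangian :: "'a mpec \<Rightarrow> 'a \<Rightarrow> real \<Rightarrow> multiplier \<Rightarrow> real" where
  "lagrangian P x m0 m =
     m0 * objective P x
     + (\<Sum>i=1..dim_l P. mul_g m i * con_g P i x)
     + (\<Sum>i=1..dim_p P. mul_h m i * con_h P i x)
     - (\<Sum>i=1..dim_q P. mul_G m i * con_G P i x)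
     - (\<Sum>i=1..dim_q P. mul_H m i * con_H P i x)"

definition Lambda1 :: "('a::real_inner) mpec \<Rightarrow> 'a \<Rightarrow> multiplier set" where
  "Lambda1 P x =
     {m \<in> multiplier_space P.
        gradient (\<lambda>y. lagrangian P y 1 m) x = 0 \<and>
        (\<forall>i\<in>{1..dim_l P}. mul_g m i \<ge> 0 \<and> mul_g m i * con_g P i x = 0) \<and>
        (\<forall>i\<in>I_0p P x. mul_H m i = 0) \<and>
        (\<forall>i\<in>I_p0 P x. mul_G m i = 0) \<and>
        (\<forall>i\<in>I_00 P x. (mul_G m i > 0 \<and> mul_H m i > 0) \<or> mul_G m i * mul_H m i = 0)}"

definition Lambda1_hat :: "('a::real_inner) mpec \<Rightarrow> 'a \<Rightarrow> multiplier set" where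
  "Lambda1_hat P x =
     {m \<in> multiplier_space P.
        gradient (\<lambda>y. lagrangian P y 1 m) x = 0 \<and>
        (\<forall>i\<in>{1..dim_l P}. mul_g m i \<ge> 0 \<and> mul_g m i * con_g P i x = 0) \<and>
        (\<forall>i\<in>I_0p P x. mul_H m i = 0) \<and>
        (\<forall>i\<in>I_p0 P x. mul_G m i = 0) \<and>
        (\<forall>i\<in>I_00 P x. mul_G m i \<ge> 0 \<and> mul_H m i \<ge> 0)}"

definition S_stationary :: "('a::real_inner) mpec \<Rightarrow> 'a \<Rightarrow> bool" where
  "S_stationary P x \<longleftrightarrow> Lambda1_hat P x \<noteq> {}"

definition strongly_M_stationary :: "('a::real_inner) mpec \<Rightarrow> 'a \<Rightarrow> bool" where
  "strongly_M_stationary P x \<longleftrightarrow>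
     (\<exists>Jg JG JH. \<exists>m \<in> Lambda1 P x.
        mpec_working_set P x Jg JG JH \<and>
        (\<forall>i\<in>{1..dim_l P} - Jg. mul_g m i = 0) \<and>
        (\<forall>i\<in>{1..dim_q P} - JG. mul_G m i = 0) \<and>
        (\<forall>i\<in>{1..dim_q P} - JH. mul_H m i = 0) \<and>
        (\<forall>i\<in>JG \<inter> JH. mul_G m i \<ge> 0 \<and> mul_H m i \<ge> 0))"

end

theory Submission
  imports Defs
begin

text \<open>Under LICQ the rank of the active gradient family is the number of its members, so a working set,
  having exactly that many labels, consists of all active constraints; in particular
  \<open>J\<^sub>G \<inter> J\<^sub>H\<close> is the biactive set. The sign conditions of strong M-stationarity are then
  those of S-stationarity.\<close>

text \<open>The constructors \<open>Cg\<close>, \<open>Ch\<close>, \<open>CG\<close>,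
  \<open>CH\<close> are injective with disjoint ranges, so the four blocks of labels never overlap.
  This turns the sum of cardinalities in \<open>mpec_working_set\<close> into the size of a single
  label set.\<close>

lemma card_constraint_labels:
  assumes "finite Jg" "finite JG" "finite JH"
  shows "card (constraint_labels P Jg JG JH) = card Jg + dim_p P + card JG + card JH"
proof -
  define I where "I = {1..dim_p P}"
  have "card (Cg ` Jg \<union> Ch ` I \<union> CG ` JG \<union> CH ` JH) =
      card (Cg ` Jg) + card (Ch ` I) + card (CG ` JG) + card (CH ` JH)"
  proof -
    have "finite I" "Cg ` Jg \<inter> Ch ` I = {}" "(Cg ` Jg \<union> Ch ` I) \<inter> CG ` JG = {}"
      "(Cg ` Jg \<union> Ch ` I \<union> CG ` JG) \<inter> CH ` JH = {}"
      unfolding I_def by auto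
    then show ?thesis using assms by (simp add: card_Un_disjoint)
  qed
  also have "\<dots> = card Jg + card I + card JG + card JH"
    by (simp add: card_image inj_on_def)
  finally show ?thesis
    unfolding constraint_labels_def I_def by simp
qed

lemma mem_constraint_labels [simp]:
  "Cg i \<in> constraint_labels P Jg JG JH \<longleftrightarrow> i \<in> Jg"
  "CG i \<in> constraint_labels P Jg JG JH \<longleftrightarrow> i \<in> JG"
  "CH i \<in> constraint_labels P Jg JG JH \<longleftrightarrow> i \<in> JH"
  by (auto simp: constraint_labels_def)

text \<open>Transfers inclusions between index triples and label sets in both directions; the
  \<open>Ch\<close> block is the same on both sides.\<close>

lemma constraint_labels_subset_iff:
  "constraint_labels P Jg JG JH \<subseteq> constraint_labels P Kg KG KH \<longleftrightarrow>
     Jg \<subseteq> Kg \<and> JG \<subseteq> KG \<and> JH \<subseteq> KH"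
proof
  assume sub: "constraint_labels P Jg JG JH \<subseteq> constraint_labels P Kg KG KH"
  show "Jg \<subseteq> Kg \<and> JG \<subseteq> KG \<and> JH \<subseteq> KH"
  proof (intro conjI subsetI)
    show "i \<in> Kg" if "i \<in> Jg" for i using subsetD[OF sub, of "Cg i"] that by simp
    show "i \<in> KG" if "i \<in> JG" for i using subsetD[OF sub, of "CG i"] that by simp
    show "i \<in> KH" if "i \<in> JH" for i using subsetD[OF sub, of "CH i"] that by simp
  qed
next
  assume "Jg \<subseteq> Kg \<and> JG \<subseteq> KG \<and> JH \<subseteq> KH"
  then show "constraint_labels P Jg JG JH \<subseteq> constraint_labels P Kg KG KH"
    unfolding constraint_labels_def by (intro Un_mono image_mono subset_refl) simp_all
qed

text \<open>Injectivity preserves the number of members when passing to the range, and the dimension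
  of an independent set is its cardinality.\<close>

lemma family_rank_independent:
  "independent_family K v \<Longrightarrow> family_rank K v = card K"
  unfolding independent_family_def family_rank_def
  by (simp add: dim_eq_card_independent card_image)

lemma finite_active [simp]:
  "finite (I_g P x)" "finite (I_p0 P x)" "finite (I_0p P x)" "finite (I_00 P x)"
  unfolding I_g_def I_p0_def I_0p_def I_00_def by auto

text \<open>Complementarity makes one of the two nonnegative values vanish, which leaves exactly the
  three sign patterns.\<close>

lemma feasible_index_partition:
  assumes "feasible P x"
  shows "I_p0 P x \<union> I_0p P x \<union> I_00 P x = {1..dim_q P}"
proof -
  have "i \<in> I_p0 P x \<union> I_0p P x \<union> I_00 P x" if i: "i \<in> {1..dim_q P}" for i
  proof -
    have "con_G P i x \<ge> 0" "con_H P i x \<ge> 0" "con_G P i x = 0 \<or> con_H P i x = 0"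
      using assms i unfolding feasible_def by auto
    then show ?thesis
      using i unfolding I_p0_def I_0p_def I_00_def by auto
  qed
  moreover have "I_p0 P x \<subseteq> {1..dim_q P}" "I_0p P x \<subseteq> {1..dim_q P}" "I_00 P x \<subseteq> {1..dim_q P}"
    by (auto simp: I_p0_def I_0p_def I_00_def)
  ultimately show ?thesis by blast
qed

lemma mpec_working_set_iff_LICQ:
  fixes P :: "('a::euclidean_space) mpec"
  assumes "feasible P x" and "mpec_LICQ P x"
  shows "mpec_working_set P x Jg JG JH \<longleftrightarrow>
    Jg = I_g P x \<and> JG = I_0p P x \<union> I_00 P x \<and> JH = I_p0 P x \<union> I_00 P x"
proof -
  have rank: "mpec_rank P x = card (active_labels P x)"
    using assms(2) unfolding mpec_LICQ_def mpec_rank_def by (rule family_rank_independent)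
  show ?thesis
  proof
    assume W: "mpec_working_set P x Jg JG JH"
    then have sub: "Jg \<subseteq> I_g P x" "JG \<subseteq> I_0p P x \<union> I_00 P x" "JH \<subseteq> I_p0 P x \<union> I_00 P x"
      and card_eq: "card Jg + dim_p P + card JG + card JH = mpec_rank P x"
      unfolding mpec_working_set_def by auto
    have fin: "finite Jg" "finite JG" "finite JH"
      using sub by (auto intro: finite_subset)
    \<comment> \<open>A subset of a finite set with the same cardinality is the whole set.\<close>
    have "constraint_labels P Jg JG JH = active_labels P x"
    proof (rule card_subset_eq)
      show "finite (active_labels P x)"
        unfolding active_labels_def constraint_labels_def by simp
      show "constraint_labels P Jg JG JH \<subseteq> active_labels P x"
        using sub by (simp add: active_labels_def constraint_labels_subset_iff)
      show "card (constraint_labels P Jg JG JH) = card (active_labels P x)"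
        using card_constraint_labels[OF fin, of P] card_eq rank by metis
    qed
    then have "active_labels P x \<subseteq> constraint_labels P Jg JG JH" by simp
    with sub show "Jg = I_g P x \<and> JG = I_0p P x \<union> I_00 P x \<and> JH = I_p0 P x \<union> I_00 P x"
      unfolding active_labels_def constraint_labels_subset_iff by blast
  next
    assume J: "Jg = I_g P x \<and> JG = I_0p P x \<union> I_00 P x \<and> JH = I_p0 P x \<union> I_00 P x"
    then have "card Jg + dim_p P + card JG + card JH = mpec_rank P x"
      by (simp add: rank active_labels_def card_constraint_labels)
    moreover have "independent_family (constraint_labels P Jg JG JH) (constraint_gradient P x)"
      using assms(2) J by (simp add: mpec_LICQ_def active_labels_def)
    \<comment> \<open>The covering condition of a working set is where feasibility enters.\<close>
    moreover have "JG \<union> JH = {1..dim_q P}"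
      using J feasible_index_partition[OF assms(1)] by blast
    ultimately show "mpec_working_set P x Jg JG JH"
      using J unfolding mpec_working_set_def by blast
  qed
qed

text \<open>Two nonnegative reals are either both positive or have product zero, so the biactive
  condition of \<open>Lambda1_hat\<close> implies that of \<open>Lambda1\<close>; all other
  conditions coincide.\<close>

lemma Lambda1_hat_iff:
  "m \<in> Lambda1_hat P x \<longleftrightarrow>
     m \<in> Lambda1 P x \<and> (\<forall>i\<in>I_00 P x. mul_G m i \<ge> 0 \<and> mul_H m i \<ge> 0)"
proof -
  have sign: "(a > 0 \<and> b > 0) \<or> a * b = 0" if "a \<ge> 0 \<and> b \<ge> 0" for a b :: real
    using that by auto
  show ?thesis
  proof
    assume "m \<in> Lambda1_hat P x"
    then show "m \<in> Lambda1 P x \<and> (\<forall>i\<in>I_00 P x. mul_G m i \<ge> 0 \<and> mul_H m i \<ge> 0)"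
      unfolding Lambda1_hat_def Lambda1_def mem_Collect_eq using sign by simp
  qed (simp add: Lambda1_hat_def Lambda1_def)
qed

text \<open>For \<open>mul_g\<close> this is complementary slackness. For \<open>mul_G\<close>, an
  index outside \<open>I_0p\<close> and \<open>I_00\<close> lies in \<open>I_p0\<close> by the
  partition, where \<open>Lambda1\<close> forces zero; \<open>mul_H\<close> is symmetric.\<close>

lemma Lambda1_vanishes_inactive:
  assumes "feasible P x" and "m \<in> Lambda1 P x"
  shows "\<forall>i\<in>{1..dim_l P} - I_g P x. mul_g m i = 0"
    and "\<forall>i\<in>{1..dim_q P} - (I_0p P x \<union> I_00 P x). mul_G m i = 0"
    and "\<forall>i\<in>{1..dim_q P} - (I_p0 P x \<union> I_00 P x). mul_H m i = 0"
proof -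
  have m: "\<forall>i\<in>{1..dim_l P}. mul_g m i * con_g P i x = 0"
    "\<forall>i\<in>I_0p P x. mul_H m i = 0" "\<forall>i\<in>I_p0 P x. mul_G m i = 0"
    using assms(2) unfolding Lambda1_def by blast+
  show "\<forall>i\<in>{1..dim_l P} - I_g P x. mul_g m i = 0"
    using m(1) by (auto simp: I_g_def)
  show "\<forall>i\<in>{1..dim_q P} - (I_0p P x \<union> I_00 P x). mul_G m i = 0"
    and "\<forall>i\<in>{1..dim_q P} - (I_p0 P x \<union> I_00 P x). mul_H m i = 0"
    using m(2,3) feasible_index_partition[OF assms(1)] by blast+
qed

lemma strongly_M_stationary_iff_S_stationary:
  fixes P :: "('a::euclidean_space) mpec"
  assumes "feasible P x" and "mpec_LICQ P x"
  shows "strongly_M_stationary P x \<longleftrightarrow> S_stationary P x"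
proof -
  \<comment> \<open>\<open>I_0p\<close> and \<open>I_p0\<close> are disjoint because
    \<open>con_G\<close> is zero on one and positive on the other.\<close>
  have biactive: "(I_0p P x \<union> I_00 P x) \<inter> (I_p0 P x \<union> I_00 P x) = I_00 P x"
    by (auto simp: I_0p_def I_p0_def)
  have "strongly_M_stationary P x \<longleftrightarrow>
      (\<exists>m\<in>Lambda1 P x. \<forall>i\<in>I_00 P x. mul_G m i \<ge> 0 \<and> mul_H m i \<ge> 0)"
    \<comment> \<open>The quantified working set is now a fixed triple, off which every element of
      \<open>Lambda1\<close> vanishes; only the sign condition on \<open>I_00\<close>
      remains.\<close>
    unfolding strongly_M_stationary_def mpec_working_set_iff_LICQ[OF assms]
    using Lambda1_vanishes_inactive[OF assms(1)] biactive by metis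
  also have "\<dots> \<longleftrightarrow> S_stationary P x"
    unfolding S_stationary_def using Lambda1_hat_iff by blast
  finally show ?thesis .
qed

theorem theorem4p4:
  fixes P :: "(real ^ 'n) mpec" and xbar :: "real ^ 'n"
  assumes "continuously_differentiable (objective P)"
    and "twice_frechet_differentiable_at (objective P) xbar"
    and "\<And>i. i \<in> {1..dim_l P} \<Longrightarrow>
           continuously_differentiable (con_g P i) \<and> twice_frechet_differentiable_at (con_g P i) xbar"
    and "\<And>i. i \<in> {1..dim_p P} \<Longrightarrow>
           continuously_differentiable (con_h P i) \<and> twice_frechet_differentiable_at (con_h P i) xbar"
    and "\<And>i. i \<in> {1..dim_q P} \<Longrightarrow>
           continuously_differentiable (con_G P i) \<and> twice_frechet_differentiable_at (con_G P i) xbar"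
    and "\<And>i. i \<in> {1..dim_q P} \<Longrightarrow>
           continuously_differentiable (con_H P i) \<and> twice_frechet_differentiable_at (con_H P i) xbar"
    and "feasible P xbar"
    and "mpec_LICQ P xbar"
  shows "strongly_M_stationary P xbar \<longleftrightarrow> S_stationary P xbar"
  using assms(7,8) by (rule strongly_M_stationary_iff_S_stationary)

end
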